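(* Let $\eta\in\mathbb{R}$, let $G$ be a (weakly connected) digraph equipped with its $\eta$-function $\theta$, and let $U=U(G^{\pm})$ be the Grover transfer matrix of $G^{\pm}$. For $\varepsilon\in\{+,-\}$, writing $-\varepsilon$ for the other sign, \[U_\theta^{(2,\varepsilon)}=\begin{cases}(U^2)^{\varepsilon} & \text{if } 0\le\eta<\frac{\pi}{2},\\ (U^2)^{\varepsilon}\circ R & \text{if } \eta=\frac{\pi}{2},\\ (U^2)^{\varepsilon}\circ R+(U^2)^{-\varepsilon}\circ(J-R) & \text{if } \frac{\pi}{2}<\eta\le\pi,\end{cases}\] where $\circ$ is the Hadamard (entrywise) product and $J$ is the all-ones matrix indexed by $A(G)^{\pm1}$.
   Context: A digraph $G$ has finite vertex set $V(G)$ and arc set $A(G)\subseteq V(G)\times V(G)\setminus\{(x,x)\}$. For $a=(u,v)$: $o(a)=u$, $t(a)=v$, $a^{-1}=(v,u)$; $A(G)^{\pm1}=A(G)\cup A(G)^{-1}$. $G^{\pm}=(V(G),A(G)^{\pm1})$ is the underlying simple undirected graph, assumed connected; $\deg x=\deg_{G^{\pm}}x$. The $\eta$-function: $\theta(a)=\eta$ if $a\in A(G)\setminus A(G)^{-1}$, $-\eta$ if $a\in A(G)^{-1}\setminus A(G)$, $0$ if $a\in A(G)\cap A(G)^{-1}$. Matrices indexed by $A(G)^{\pm1}$: $K_{v,a}=\delta_{v,t(a)}/\sqrt{\deg t(a)}$, $C=2K^*K-I$, $(S_\theta)_{ab}=e^{i\theta(b)}\delta_{a,b^{-1}}$, $U_\theta=S_\theta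 C$, $D_\theta$ diagonal with $(D_\theta)_{aa}=e^{i\theta(a)}$; the Grover transfer matrix $U_{ab}=\frac{2}{\deg t(b)}\delta_{t(b),o(a)}-\delta_{a^{-1},b}$. $U_\theta^{(2,+)}$ (resp. $U_\theta^{(2,-)}$) is the $\{0,1\}$-matrix with $(a,b)$-entry $1$ iff $\mathrm{Re}(D_\theta U_\theta^2)_{ab}>0$ (resp. $<0$). For a real matrix $M$, $M^{+}$ (resp. $M^{-}$) is the $\{0,1\}$-matrix with entry $1$ exactly where $M_{xy}>0$ (resp. $<0$). For arcs $a,b$ let $m(a,b)=(t(b),o(a))$ (an ordered pair, not necessarily an arc); $R$ is the matrix indexed by $A(G)^{\pm1}$ with $R_{ab}=1$ if $m(a,b)\in A(G)\cap A(G)^{-1}$ and $R_{ab}=0$ otherwise. *)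

theory Defs
  imports "HOL-Analysis.Analysis" "Graph_Theory.Graph_Theory"
begin

text \<open>
  Matrices are functions of a row and a column index. Their index sets are finite sets given
  explicitly: they bound the summation in a product and the range of an equality, and entries
  outside them carry no meaning.
\<close>

type_synonym ('i, 'j, 'c) matr = "'i \<Rightarrow> 'j \<Rightarrow> 'c"

definition mprod :: "'j set \<Rightarrow> ('i, 'j, 'c::comm_semiring_1) matr \<Rightarrow> ('j, 'k, 'c) matr \<Rightarrow> ('i, 'k, 'c) matr" where
  "mprod J M N = (\<lambda>a b. \<Sum>c\<in>J. M a c * N c b)"

definition msquare :: "'i set \<Rightarrow> ('i, 'i, 'c::comm_semiring_1) matr \<Rightarrow> ('i, 'i, 'c) matr" where
  "msquare I M = mprod I M M"

definition madd :: "('i, 'j, real) matr \<Rightarrow> ('i, 'j, real) matr \<Rightarrow> ('i, 'j, real) matr" (infixl "\<oplus>\<^sub>M" 65) where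
  "M \<oplus>\<^sub>M N = (\<lambda>a b. M a b + N a b)"

definition mdiff :: "('i, 'j, real) matr \<Rightarrow> ('i, 'j, real) matr \<Rightarrow> ('i, 'j, real) matr" (infixl "\<ominus>\<^sub>M" 65) where
  "M \<ominus>\<^sub>M N = (\<lambda>a b. M a b - N a b)"

definition hadamard :: "('i, 'j, real) matr \<Rightarrow> ('i, 'j, real) matr \<Rightarrow> ('i, 'j, real) matr" (infixl "\<odot>\<^sub>M" 70) where
  "M \<odot>\<^sub>M N = (\<lambda>a b. M a b * N a b)"

definition all_ones :: "('i, 'j, real) matr" where
  "all_ones = (\<lambda>a b. 1)"

definition adjoint_mat :: "('i, 'j, complex) matr \<Rightarrow> ('j, 'i, complex) matr" where
  "adjoint_mat M = (\<lambda>a b. cnj (M b a))"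

definition Re_mat :: "('i, 'j, complex) matr \<Rightarrow> ('i, 'j, real) matr" where
  "Re_mat M = (\<lambda>a b. Re (M a b))"

definition mat_eq_on :: "'i set \<Rightarrow> ('i, 'i, 'c) matr \<Rightarrow> ('i, 'i, 'c) matr \<Rightarrow> bool" where
  "mat_eq_on I M N \<longleftrightarrow> (\<forall>a\<in>I. \<forall>b\<in>I. M a b = N a b)"

datatype pm = Plus | Minus

primrec opposite :: "pm \<Rightarrow> pm" where
  "opposite Plus = Minus"
| "opposite Minus = Plus"

primrec sign_mat :: "pm \<Rightarrow> ('i, 'j, real) matr \<Rightarrow> ('i, 'j, real) matr" where
  "sign_mat Plus M = (\<lambda>a b. if M a b > 0 then 1 else 0)"
| "sign_mat Minus M = (\<lambda>a b. if M a b < 0 then 1 else 0)"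

text \<open>
  For an arc \<open>a = (u, v)\<close> the origin is \<open>fst a\<close>, the terminus is \<open>snd a\<close> and
  the inverse is \<open>prod.swap a\<close>. The underlying undirected graph is rendered as the
  symmetric digraph \<open>mk_symmetric G\<close>.
\<close>

definition arcs_pm :: "'v pair_pre_digraph \<Rightarrow> ('v \<times> 'v) set" where
  "arcs_pm G = parcs G \<union> (parcs G)\<inverse>"

lemma parcs_mk_symmetric_arcs_pm: "parcs (mk_symmetric (with_proj G)) = arcs_pm G"
  by (force simp: parcs_mk_symmetric arcs_pm_def)

text \<open>
  Each undirected edge at \<open>x\<close> is exactly one arc of \<open>mk_symmetric G\<close> leaving \<open>x\<close>,
  so the out-degree there is the undirected degree.
\<close>

definition udeg :: "'v pair_pre_digraph \<Rightarrow> 'v \<Rightarrow> nat" where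
  "udeg G x = out_degree (with_proj (mk_symmetric (with_proj G))) x"

definition eta_fun :: "'v pair_pre_digraph \<Rightarrow> real \<Rightarrow> 'v \<times> 'v \<Rightarrow> real" where
  "eta_fun G \<eta> a =
    (if a \<in> parcs G - (parcs G)\<inverse> then \<eta>
     else if a \<in> (parcs G)\<inverse> - parcs G then - \<eta>
     else 0)"

definition K_mat :: "'v pair_pre_digraph \<Rightarrow> ('v, 'v \<times> 'v, complex) matr" where
  "K_mat G = (\<lambda>v a. of_bool (v = snd a) / complex_of_real (sqrt (real (udeg G (snd a)))))"

definition C_mat :: "'v pair_pre_digraph \<Rightarrow> ('v \<times> 'v, 'v \<times> 'v, complex) matr" where
  "C_mat G = (\<lambda>a b. 2 * mprod (pverts G) (adjoint_mat (K_mat G)) (K_mat G) a b - of_bool (a = b))"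

definition S_mat :: "('v \<times> 'v \<Rightarrow> real) \<Rightarrow> ('v \<times> 'v, 'v \<times> 'v, complex) matr" where
  "S_mat \<theta> = (\<lambda>a b. exp (\<i> * complex_of_real (\<theta> b)) * of_bool (a = prod.swap b))"

definition U_theta :: "'v pair_pre_digraph \<Rightarrow> ('v \<times> 'v \<Rightarrow> real) \<Rightarrow> ('v \<times> 'v, 'v \<times> 'v, complex) matr" where
  "U_theta G \<theta> = mprod (arcs_pm G) (S_mat \<theta>) (C_mat G)"

definition D_mat :: "('v \<times> 'v \<Rightarrow> real) \<Rightarrow> ('v \<times> 'v, 'v \<times> 'v, complex) matr" where
  "D_mat \<theta> = (\<lambda>a b. if a = b then exp (\<i> * complex_of_real (\<theta> a)) else 0)"

definition U_theta_2 :: "pm \<Rightarrow> 'v pair_pre_digraph \<Rightarrow> ('v \<times> 'v \<Rightarrow> real) \<Rightarrow> ('v \<times> 'v, 'v \<times> 'v, real) matr" where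
  "U_theta_2 \<epsilon> G \<theta> =
    sign_mat \<epsilon> (Re_mat (mprod (arcs_pm G) (D_mat \<theta>) (msquare (arcs_pm G) (U_theta G \<theta>))))"

definition grover_transfer :: "'v pair_pre_digraph \<Rightarrow> ('v \<times> 'v, 'v \<times> 'v, real) matr" where
  "grover_transfer G =
    (\<lambda>a b. 2 / real (udeg G (snd b)) * of_bool (snd b = fst a) - of_bool (prod.swap a = b))"

definition R_mat :: "'v pair_pre_digraph \<Rightarrow> ('v \<times> 'v, 'v \<times> 'v, real) matr" where
  "R_mat G = (\<lambda>a b. if (snd b, fst a) \<in> parcs G \<inter> (parcs G)\<inverse> then 1 else 0)"

end

theory Submission
  imports Defs
begin

text \<open>
  Since \<open>U\<^sub>\<theta> = D\<^sub>\<theta>\<^sup>-\<^sup>1 U\<close>, the matrix \<open>D\<^sub>\<theta> U\<^sub>\<theta>\<^sup>2\<close> equals \<open>U D\<^sub>\<theta>\<^sup>-\<^sup>1 U\<close>. Only the arc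
  \<open>m(a, b) = (t(b), o(a))\<close> can lead from \<open>b\<close> to \<open>a\<close> in two steps, so the sum defining the
  \<open>(a, b)\<close>-entry has a single term, and the real part of that entry is
  \<open>cos (\<theta> (m(a, b)))\<close> times the entry of \<open>U\<^sup>2\<close>. This cosine is \<open>1\<close> where \<open>R\<close> is \<open>1\<close>; elsewhere
  it is \<open>cos \<eta>\<close>, or the entry of \<open>U\<^sup>2\<close> vanishes.
\<close>

lemma swap_mem_arcs_pm_iff [simp]: "prod.swap a \<in> arcs_pm G \<longleftrightarrow> a \<in> arcs_pm G"
  by (cases a) (auto simp: arcs_pm_def)

lemma eta_fun_swap: "eta_fun G \<eta> (prod.swap a) = - eta_fun G \<eta> a"
  by (cases a) (auto simp: eta_fun_def)

text \<open>Cosine is even, so the orientation of a one-way arc does not matter; membership in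
  \<open>arcs_pm G\<close> rules out the default value 0 of \<open>eta_fun\<close>.\<close>

lemma cos_eta_fun:
  assumes "a \<in> arcs_pm G"
  shows "cos (eta_fun G \<eta> a) = (if a \<in> parcs G \<inter> (parcs G)\<inverse> then 1 else cos \<eta>)"
  using assms by (auto simp: eta_fun_def arcs_pm_def)

text \<open>\<open>udeg\<close> symmetrizes its argument itself, so idempotence shows that passing
  from \<open>G\<close> to its underlying graph leaves degrees, and hence the Grover matrix,
  unchanged.\<close>

lemma mk_symmetric_idem:
  "mk_symmetric (with_proj (mk_symmetric (with_proj G))) = mk_symmetric (with_proj G)"
proof (rule pair_pre_digraph.equality)
  show "parcs (mk_symmetric (with_proj (mk_symmetric (with_proj G)))) = parcs (mk_symmetric (with_proj G))"
    by (auto simp: parcs_mk_symmetric_arcs_pm arcs_pm_def)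
qed (simp_all add: mk_symmetric_def)

lemma udeg_mk_symmetric: "udeg (mk_symmetric (with_proj G)) = udeg G"
  by (simp add: udeg_def mk_symmetric_idem fun_eq_iff)

lemma grover_transfer_mk_symmetric: "grover_transfer (mk_symmetric (with_proj G)) = grover_transfer G"
  by (simp add: grover_transfer_def udeg_mk_symmetric)

lemma grover_transfer_eq_0:
  "snd b \<noteq> fst a \<Longrightarrow> grover_transfer G a b = 0"
  by (auto simp: grover_transfer_def)

context pair_fin_digraph
begin

lemma finite_arcs_pm: "finite (arcs_pm G)"
  by (simp add: arcs_pm_def)

lemma arcs_pm_in_pverts:
  assumes "a \<in> arcs_pm G"
  shows "fst a \<in> pverts G" "snd a \<in> pverts G"
  using assms by (auto simp: arcs_pm_def dest: in_arcsD1 in_arcsD2)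

text \<open>In the product of \<open>K_mat\<close> with its adjoint only the common terminus of
  \<open>a\<close> and \<open>b\<close> contributes, with two factors of one over the square root of
  its degree.\<close>

lemma C_mat_eq:
  assumes "b \<in> arcs_pm G"
  shows "C_mat G a b = of_real (grover_transfer G (prod.swap a) b)"
proof -
  let ?d = "udeg G (snd b)"
  have sqrt_sq: "complex_of_real (sqrt n) * complex_of_real (sqrt n) = of_nat n" for n :: nat
    by (metis of_nat_0_le_iff of_real_mult of_real_of_nat_eq real_sqrt_mult_self abs_of_nonneg)
  have "mprod (pverts G) (adjoint_mat (K_mat G)) (K_mat G) a b =
      (\<Sum>v\<in>pverts G. if v = snd b then of_bool (snd b = snd a) / of_nat ?d else 0)"
    unfolding mprod_def by (rule sum.cong) (auto simp: adjoint_mat_def K_mat_def sqrt_sq)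
  also have "\<dots> = of_bool (snd b = snd a) / of_nat ?d"
    using arcs_pm_in_pverts(2)[OF assms] by (simp add: sum.delta)
  finally show ?thesis
    by (simp add: C_mat_def grover_transfer_def)
qed

text \<open>Row \<open>a\<close> of \<open>S_mat\<close> has its only nonzero entry in column
  \<open>prod.swap a\<close>; the two swaps of \<open>a\<close> then cancel. As
  \<open>\<theta>\<close> is arbitrary here, its phase stays at the swapped arc.\<close>

lemma U_theta_eq:
  assumes "a \<in> arcs_pm G" "b \<in> arcs_pm G"
  shows "U_theta G \<theta> a b =
    exp (\<i> * of_real (\<theta> (prod.swap a))) * of_real (grover_transfer G a b)"
proof -
  have "U_theta G \<theta> a b = (\<Sum>c\<in>arcs_pm G.
      if c = prod.swap a then exp (\<i> * of_real (\<theta> (prod.swap a))) * C_mat G (prod.swap a) b else 0)"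
    unfolding U_theta_def mprod_def by (rule sum.cong) (auto simp: S_mat_def)
  then show ?thesis
    using assms by (simp add: sum.delta finite_arcs_pm C_mat_eq)
qed

lemma mprod_D_mat:
  assumes "a \<in> arcs_pm G"
  shows "mprod (arcs_pm G) (D_mat \<theta>) M a b = exp (\<i> * of_real (\<theta> a)) * M a b"
proof -
  have "mprod (arcs_pm G) (D_mat \<theta>) M a b =
      (\<Sum>c\<in>arcs_pm G. if c = a then exp (\<i> * of_real (\<theta> a)) * M a b else 0)"
    unfolding mprod_def by (rule sum.cong) (auto simp: D_mat_def)
  then show ?thesis
    using assms by (simp add: sum.delta finite_arcs_pm)
qed

text \<open>The weight \<open>f\<close> lets one collapse serve twice: constant 1 gives the square
  of the Grover matrix, the phases of the middle arcs give its twisted version.\<close>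

lemma sum_grover_transfer_paths:
  fixes f :: "'a \<times> 'a \<Rightarrow> 'c::real_algebra_1"
  shows "(\<Sum>c\<in>arcs_pm G. f c * of_real (grover_transfer G a c * grover_transfer G c b)) =
    (if (snd b, fst a) \<in> arcs_pm G
     then f (snd b, fst a) * of_real (grover_transfer G a (snd b, fst a) * grover_transfer G (snd b, fst a) b)
     else 0)"
proof -
  have "(\<Sum>c\<in>arcs_pm G. f c * of_real (grover_transfer G a c * grover_transfer G c b)) =
    (\<Sum>c\<in>arcs_pm G. if c = (snd b, fst a)
      then f (snd b, fst a) * of_real (grover_transfer G a (snd b, fst a) * grover_transfer G (snd b, fst a) b)
      else 0)"
  proof (rule sum.cong)
    fix c
    \<comment> \<open>A nonzero left factor forces the terminus of \<open>c\<close> to be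
      \<open>fst a\<close>, a nonzero right factor its origin to be \<open>snd b\<close>.\<close>
    have "grover_transfer G a c * grover_transfer G c b = 0" if "c \<noteq> (snd b, fst a)"
      using that grover_transfer_eq_0[of c a G] grover_transfer_eq_0[of b c G]
      by (cases c) auto
    then show "f c * of_real (grover_transfer G a c * grover_transfer G c b) = (if c = (snd b, fst a)
        then f (snd b, fst a) * of_real (grover_transfer G a (snd b, fst a) * grover_transfer G (snd b, fst a) b)
        else 0)"
      by (metis mult_zero_right of_real_0)
  qed simp
  then show ?thesis
    by (simp add: sum.delta finite_arcs_pm)
qed

lemma msquare_grover_transfer:
  "msquare (arcs_pm G) (grover_transfer G) a b =
    (if (snd b, fst a) \<in> arcs_pm G
     then grover_transfer G a (snd b, fst a) * grover_transfer G (snd b, fst a) b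
     else 0)"
  using sum_grover_transfer_paths[of "\<lambda>_. 1::real" a b] by (simp add: msquare_def mprod_def)

lemma Re_D_U_theta_square:
  assumes "a \<in> arcs_pm G" "b \<in> arcs_pm G"
  shows "Re_mat (mprod (arcs_pm G) (D_mat (eta_fun G \<eta>))
           (msquare (arcs_pm G) (U_theta G (eta_fun G \<eta>)))) a b =
         cos (eta_fun G \<eta> (snd b, fst a)) * msquare (arcs_pm G) (grover_transfer G) a b"
proof -
  let ?\<theta> = "eta_fun G \<eta>" and ?U = "grover_transfer G" and ?m = "(snd b, fst a)"
  have "mprod (arcs_pm G) (D_mat ?\<theta>) (msquare (arcs_pm G) (U_theta G ?\<theta>)) a b =
      (\<Sum>c\<in>arcs_pm G. exp (\<i> * of_real (?\<theta> a)) * (U_theta G ?\<theta> a c * U_theta G ?\<theta> c b))"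
    using assms by (simp add: mprod_D_mat msquare_def mprod_def[of _ "U_theta G ?\<theta>"] sum_distrib_left)
  \<comment> \<open>By antisymmetry of \<open>eta_fun\<close> the phase from \<open>D_mat\<close>
    cancels that of the left factor, and only the phase of the middle arc survives.\<close>
  also have "\<dots> = (\<Sum>c\<in>arcs_pm G. cis (- ?\<theta> c) * of_real (?U a c * ?U c b))"
    using assms
    by (intro sum.cong) (auto simp: U_theta_eq eta_fun_swap cis_conv_exp exp_minus field_simps)
  finally show ?thesis
    unfolding sum_grover_transfer_paths by (simp add: Re_mat_def msquare_grover_transfer)
qed

end

theorem theorem6p13:
  fixes G :: "'v pair_pre_digraph" and \<eta> :: real and \<epsilon> :: pm
  assumes "pair_digraph G"
    and "Digraph_Component.connected (with_proj G)"
  shows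
    "let A = arcs_pm G;
         U2 = msquare A (grover_transfer (mk_symmetric (with_proj G)));
         W = U_theta_2 \<epsilon> G (eta_fun G \<eta>);
         R = R_mat G;
         J = all_ones
     in (0 \<le> \<eta> \<and> \<eta> < pi / 2 \<longrightarrow> mat_eq_on A W (sign_mat \<epsilon> U2)) \<and>
        (\<eta> = pi / 2 \<longrightarrow> mat_eq_on A W (sign_mat \<epsilon> U2 \<odot>\<^sub>M R)) \<and>
        (pi / 2 < \<eta> \<and> \<eta> \<le> pi \<longrightarrow>
           mat_eq_on A W (sign_mat \<epsilon> U2 \<odot>\<^sub>M R \<oplus>\<^sub>M sign_mat (opposite \<epsilon>) U2 \<odot>\<^sub>M (J \<ominus>\<^sub>M R)))"
proof -
  interpret pair_digraph G by (rule assms(1))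
  let ?U2 = "msquare (arcs_pm G) (grover_transfer G)"
  let ?V = "Re_mat (mprod (arcs_pm G) (D_mat (eta_fun G \<eta>))
    (msquare (arcs_pm G) (U_theta G (eta_fun G \<eta>))))"
  have V: "?V a b = (if R_mat G a b = 1 then 1 else cos \<eta>) * ?U2 a b"
    if "a \<in> arcs_pm G" "b \<in> arcs_pm G" for a b
  proof (cases "(snd b, fst a) \<in> arcs_pm G")
    case True
    then show ?thesis
      by (simp add: Re_D_U_theta_square[OF that] cos_eta_fun[OF True] R_mat_def)
  next
    \<comment> \<open>The two cosine factors may differ here, but the entry of \<open>?U2\<close> is
      0.\<close>
    case False
    then show ?thesis
      by (simp add: Re_D_U_theta_square[OF that] msquare_grover_transfer)
  qed
  have R: "R_mat G a b = 0 \<or> R_mat G a b = 1" for a b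
    by (simp add: R_mat_def)
  have "mat_eq_on (arcs_pm G) (sign_mat \<epsilon> ?V) (sign_mat \<epsilon> ?U2)" if "0 \<le> \<eta>" "\<eta> < pi / 2"
  proof -
    \<comment> \<open>A positive factor preserves every sign, whatever the value of
      \<open>R_mat\<close>.\<close>
    have "cos \<eta> > 0"
      using that by (intro cos_gt_zero_pi) auto
    then show ?thesis
      by (cases \<epsilon>) (auto simp: mat_eq_on_def V zero_less_mult_iff mult_less_0_iff)
  qed
  moreover have "mat_eq_on (arcs_pm G) (sign_mat \<epsilon> ?V) (sign_mat \<epsilon> ?U2 \<odot>\<^sub>M R_mat G)"
    if "\<eta> = pi / 2"
  proof -
    \<comment> \<open>Entries where \<open>R_mat\<close> is 0 vanish and so have neither
      sign.\<close>
    have "cos \<eta> = 0"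
      unfolding that by (rule cos_pi_half)
    then show ?thesis
      using R by (cases \<epsilon>) (auto simp: mat_eq_on_def hadamard_def V)
  qed
  moreover have "mat_eq_on (arcs_pm G) (sign_mat \<epsilon> ?V)
      (sign_mat \<epsilon> ?U2 \<odot>\<^sub>M R_mat G \<oplus>\<^sub>M sign_mat (opposite \<epsilon>) ?U2 \<odot>\<^sub>M (all_ones \<ominus>\<^sub>M R_mat G))"
    if "pi / 2 < \<eta>" "\<eta> \<le> pi"
  proof -
    \<comment> \<open>The factor now reverses signs exactly where \<open>R_mat\<close> is 0, which
      is where the opposite sign matrix enters.\<close>
    have "cos \<eta> < 0"
      using that cos_monotone_0_pi[of "pi / 2" \<eta>] by simp
    then show ?thesis
      using R
      by (cases \<epsilon>) (auto simp: mat_eq_on_def hadamard_def madd_def mdiff_def all_ones_def V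
          zero_less_mult_iff mult_less_0_iff)
  qed
  ultimately show ?thesis
    by (simp add: Let_def U_theta_2_def grover_transfer_mk_symmetric)
qed

end
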